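(* Let $\mathbb{G}$ be a finite abelian group, let $L=\bigoplus_{a\in\mathbb{G}}L_a$ be a $(\mathbb{G},\theta)$-Lie algebra over $\mathbb{C}$ with bracket $[\cdot,\cdot]$, let $\alpha\in\mathbb{C}$, and let $z\in Z(L)$ be homogeneous, $z\in L_g$ with $g\in\mathbb{G}$. Define the linear map $R:L\otimes L\to L\otimes L$ on homogeneous elements $x\in L_a$, $y\in L_b$ ($a,b\in\mathbb{G}$) by $$R(x\otimes y)=\alpha\,[x,y]\otimes z+\theta(a,b)\,x\otimes y .$$ Then $R$ satisfies the constant quantum Yang-Baxter equation $$R^{12}\circ R^{13}\circ R^{23}=R^{23}\circ R^{13}\circ R^{12}$$ if and only if $\theta(g,a)=\theta(a,g)=\theta(g,g)=1$ for every $a\in\mathbb{G}$ and $x\in L_a$. When this condition holds, $R$ is invertible, and its inverse is given on homogeneous $x\in L_a$, $y\in L_b$ by $$R^{-1}(x\otimes y)=\alpha\,[y,x]\otimes z+\theta(b,a)\,x\otimes y .$$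
   Context: A $(\mathbb{G},\theta)$-Lie algebra consists of a finite abelian group $\mathbb{G}$ (written additively), a $\mathbb{G}$-graded vector space $L=\bigoplus_{a\in\mathbb{G}}L_a$, a bilinear (nonassociative) multiplication $[\cdot,\cdot]:L\times L\to L$ with $[L_a,L_b]\subseteq L_{a+b}$ for all $a,b\in\mathbb{G}$, and a function $\theta:\mathbb{G}\times\mathbb{G}\to\mathbb{C}^*$ (nonzero complex values) such that for all $a,b,c\in\mathbb{G}$ and all homogeneous $x\in L_a$, $y\in L_b$, $t\in L_c$: - $[x,y]=-\theta(a,b)[y,x]$; - $\theta(c,a)[x,[y,t]]+\theta(b,c)[t,[x,y]]+\theta(a,b)[y,[t,x]]=0$; - $\theta(a+b,c)=\theta(a,c)\theta(b,c)$, $\ \theta(a,b+c)=\theta(a,b)\theta(a,c)$, $\ \theta(a,b)\theta(b,a)=1$. The center is $Z(L)=\{z\in L: [z,x]=0\ \ \forall x\in L\}$. For a linear map $R:V\otimes V\to V\otimes V$, the maps on $V\otimes V\otimes V$ are $R^{12}=R\otimes I$, $R^{23}=I\otimes R$, $R^{13}=(I\otimes\tau)(R\otimes I)(I\otimes\tau)$, where $I$ is the identity and $\tau(v\otimes w)=w\otimes v$ is the ordinary (ungraded) twist.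
   Formalization: The "only if" half is stated for α ≠ 0, z ≠ 0 and a bracket that is not identically zero (otherwise R is diagonal and always satisfies the equation), and the condition on θ ranges only over degrees a with L_a ≠ 0, since other degrees do not affect R. *)

theory Defs
  imports Complex_Main "HOL-Library.Poly_Mapping"
begin

section \<open>Complex vector spaces\<close>

class scaleC =
  fixes scaleC :: "complex \<Rightarrow> 'a \<Rightarrow> 'a" (infixr "*\<^sub>C" 75)

class complex_vector = scaleC + ab_group_add +
  assumes scaleC_add_right: "c *\<^sub>C (x + y) = c *\<^sub>C x + c *\<^sub>C y"
    and scaleC_add_left: "(c + d) *\<^sub>C x = c *\<^sub>C x + d *\<^sub>C x"
    and scaleC_scaleC: "c *\<^sub>C d *\<^sub>C x = (c * d) *\<^sub>C x"
    and scaleC_one: "1 *\<^sub>C x = x"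

interpretation complex_vector:
  vector_space "scaleC :: complex \<Rightarrow> 'a \<Rightarrow> 'a::complex_vector"
  by standard (simp_all add: scaleC_add_right scaleC_add_left scaleC_scaleC scaleC_one)

abbreviation clinear :: "('a::complex_vector \<Rightarrow> 'b::complex_vector) \<Rightarrow> bool"
  where "clinear \<equiv> Vector_Spaces.linear scaleC scaleC"

definition cbilinear :: "('a::complex_vector \<Rightarrow> 'b::complex_vector \<Rightarrow> 'c::complex_vector) \<Rightarrow> bool"
  where "cbilinear B \<longleftrightarrow> (\<forall>x. clinear (B x)) \<and> (\<forall>y. clinear (\<lambda>x. B x y))"

lemma clinear_iff:
  "clinear f \<longleftrightarrow> (\<forall>x y. f (x + y) = f x + f y) \<and> (\<forall>c x. f (c *\<^sub>C x) = c *\<^sub>C f x)"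
  by (simp add: Vector_Spaces.linear_iff complex_vector.vector_space_axioms)

instantiation complex :: complex_vector
begin
definition scaleC_complex_def [simp]: "c *\<^sub>C (x::complex) = c * x"
instance by standard (simp_all add: algebra_simps)
end

instantiation poly_mapping :: (type, complex_vector) complex_vector
begin
definition scaleC_poly_mapping_def: "c *\<^sub>C f = Poly_Mapping.map (scaleC c) f"

lemma lookup_scaleC [simp]:
  "Poly_Mapping.lookup (c *\<^sub>C f) k = c *\<^sub>C Poly_Mapping.lookup f k"
  for f :: "'a \<Rightarrow>\<^sub>0 'b"
  by (simp add: scaleC_poly_mapping_def Poly_Mapping.map.rep_eq when_def)

instance
  by standard (auto intro!: poly_mapping_eqI
      simp: lookup_add scaleC_add_right scaleC_add_left scaleC_scaleC scaleC_one)
end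


section \<open>The algebraic tensor product\<close>

text \<open>\<open>V \<otimes> W\<close> is the free vector space \<open>V \<times> W \<Rightarrow>\<^sub>0 complex\<close> modulo the
  subspace spanned by the bilinearity relations.\<close>

definition tensor_relators ::
  "('a::complex_vector \<times> 'b::complex_vector \<Rightarrow>\<^sub>0 complex) set" where
  "tensor_relators =
     {Poly_Mapping.single (x + x', y) 1 - Poly_Mapping.single (x, y) 1
        - Poly_Mapping.single (x', y) 1 | x x' y. True} \<union>
     {Poly_Mapping.single (x, y + y') 1 - Poly_Mapping.single (x, y) 1
        - Poly_Mapping.single (x, y') 1 | x y y'. True} \<union>
     {Poly_Mapping.single (c *\<^sub>C x, y) 1 - c *\<^sub>C Poly_Mapping.single (x, y) 1 | c x y. True} \<union>
     {Poly_Mapping.single (x, c *\<^sub>C y) 1 - c *\<^sub>C Poly_Mapping.single (x, y) 1 | c x y. True}"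

definition tensor_rel ::
  "('a::complex_vector \<times> 'b::complex_vector \<Rightarrow>\<^sub>0 complex) \<Rightarrow> ('a \<times> 'b \<Rightarrow>\<^sub>0 complex) \<Rightarrow> bool"
  where "tensor_rel f g \<longleftrightarrow> f - g \<in> complex_vector.span tensor_relators"

lemma equivp_tensor_rel: "equivp tensor_rel"
proof (rule equivpI)
  show "reflp tensor_rel"
    by (simp add: reflp_def tensor_rel_def complex_vector.span_zero)
  show "symp tensor_rel"
    unfolding symp_def tensor_rel_def by (metis complex_vector.span_neg minus_diff_eq)
  show "transp tensor_rel"
    unfolding transp_def tensor_rel_def
    by (auto dest: complex_vector.span_add)
qed

quotient_type (overloaded) ('a, 'b) tensor =
  "('a::complex_vector) \<times> ('b::complex_vector) \<Rightarrow>\<^sub>0 complex" / tensor_rel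
  by (rule equivp_tensor_rel)

instantiation tensor :: (complex_vector, complex_vector) complex_vector
begin

lift_definition zero_tensor :: "('a, 'b) tensor" is 0 .

lift_definition plus_tensor :: "('a, 'b) tensor \<Rightarrow> ('a, 'b) tensor \<Rightarrow> ('a, 'b) tensor" is "(+)"
  unfolding tensor_rel_def by (drule (1) complex_vector.span_add) (simp add: algebra_simps)

lift_definition uminus_tensor :: "('a, 'b) tensor \<Rightarrow> ('a, 'b) tensor" is uminus
  unfolding tensor_rel_def by (drule complex_vector.span_neg) (simp add: algebra_simps)

lift_definition minus_tensor :: "('a, 'b) tensor \<Rightarrow> ('a, 'b) tensor \<Rightarrow> ('a, 'b) tensor" is "(-)"
  unfolding tensor_rel_def by (drule (1) complex_vector.span_diff) (simp add: algebra_simps)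

lift_definition scaleC_tensor :: "complex \<Rightarrow> ('a, 'b) tensor \<Rightarrow> ('a, 'b) tensor" is scaleC
  unfolding tensor_rel_def by (simp add: complex_vector.span_scale complex_vector.scale_right_diff_distrib[symmetric])

instance
proof
  fix x y z :: "('a, 'b) tensor" and c d :: complex
  have eq: "tensor_rel f f" for f :: "'a \<times> 'b \<Rightarrow>\<^sub>0 complex"
    by (rule equivp_reflp[OF equivp_tensor_rel])
  show "x + y + z = x + (y + z)" by transfer (simp add: add.assoc eq)
  show "x + y = y + x" by transfer (simp add: add.commute eq)
  show "0 + x = x" by transfer (simp add: eq)
  show "- x + x = 0" by transfer (simp add: eq)
  show "x - y = x + - y" by transfer (simp add: eq)
  show "c *\<^sub>C (x + y) = c *\<^sub>C x + c *\<^sub>C y" by transfer (simp add: scaleC_add_right eq)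
  show "(c + d) *\<^sub>C x = c *\<^sub>C x + d *\<^sub>C x" by transfer (simp add: scaleC_add_left eq)
  show "c *\<^sub>C d *\<^sub>C x = (c * d) *\<^sub>C x" by transfer (simp add: scaleC_scaleC eq)
  show "1 *\<^sub>C x = x" by transfer (simp add: scaleC_one eq)
qed

end

lift_definition tensor_pure :: "'a::complex_vector \<Rightarrow> 'b::complex_vector \<Rightarrow> ('a, 'b) tensor"
  (infixl "\<otimes>" 78) is "\<lambda>x y. Poly_Mapping.single (x, y) 1" .

definition free_lift ::
  "('a \<Rightarrow> 'b \<Rightarrow> 'c::complex_vector) \<Rightarrow> ('a \<times> 'b \<Rightarrow>\<^sub>0 complex) \<Rightarrow> 'c" where
  "free_lift B f = (\<Sum>p\<in>Poly_Mapping.keys f. Poly_Mapping.lookup f p *\<^sub>C B (fst p) (snd p))"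

text \<open>The linear map on the tensor product induced by a bilinear map \<open>B\<close>; it does not depend
  on the chosen representative when \<open>B\<close> is bilinear, and is meaningful only then.\<close>

definition tensor_lift ::
  "('a::complex_vector \<Rightarrow> 'b::complex_vector \<Rightarrow> 'c::complex_vector) \<Rightarrow> ('a, 'b) tensor \<Rightarrow> 'c"
  where "tensor_lift B t = free_lift B (rep_tensor t)"

subsection \<open>The universal property\<close>

lemma tensor_pure_bilinear: "cbilinear (\<otimes>)"
proof -
  have "x \<otimes> (y + y') = x \<otimes> y + x \<otimes> y'" for x :: 'a and y y' :: 'b
    by transfer (unfold tensor_rel_def tensor_relators_def diff_diff_eq[symmetric],
        rule complex_vector.span_base, blast)
  moreover have "(x + x') \<otimes> y = x \<otimes> y + x' \<otimes> y" for x x' :: 'a and y :: 'b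
    by transfer (unfold tensor_rel_def tensor_relators_def diff_diff_eq[symmetric],
        rule complex_vector.span_base, blast)
  moreover have "x \<otimes> (c *\<^sub>C y) = c *\<^sub>C (x \<otimes> y)" for c and x :: 'a and y :: 'b
    by transfer (unfold tensor_rel_def tensor_relators_def diff_diff_eq[symmetric],
        rule complex_vector.span_base, blast)
  moreover have "(c *\<^sub>C x) \<otimes> y = c *\<^sub>C (x \<otimes> y)" for c and x :: 'a and y :: 'b
    by transfer (unfold tensor_rel_def tensor_relators_def diff_diff_eq[symmetric],
        rule complex_vector.span_base, blast)
  ultimately show ?thesis by (simp add: cbilinear_def clinear_iff)
qed

lemma free_lift_superset:
  assumes "finite A" "Poly_Mapping.keys f \<subseteq> A"
  shows "free_lift B f = (\<Sum>p\<in>A. Poly_Mapping.lookup f p *\<^sub>C B (fst p) (snd p))"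
  unfolding free_lift_def
  by (rule sum.mono_neutral_left) (use assms in \<open>auto simp: in_keys_iff\<close>)

lemma free_lift_linear: "clinear (free_lift B)"
proof -
  have "free_lift B (f + g) = free_lift B f + free_lift B g" for f g
  proof -
    let ?A = "Poly_Mapping.keys f \<union> Poly_Mapping.keys g"
    have "finite ?A" by simp
    moreover have "Poly_Mapping.keys (f + g) \<subseteq> ?A" by (rule keys_add)
    ultimately show ?thesis
      by (simp add: free_lift_superset[of ?A] lookup_add scaleC_add_left sum.distrib)
  qed
  moreover have "free_lift B (c *\<^sub>C f) = c *\<^sub>C free_lift B f" for c f
  proof -
    let ?A = "Poly_Mapping.keys f"
    have "finite ?A" by simp
    moreover have "Poly_Mapping.keys (c *\<^sub>C f) \<subseteq> ?A" by (auto simp: in_keys_iff)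
    ultimately show ?thesis
      by (simp add: free_lift_superset[of ?A] complex_vector.scale_sum_right)
  qed
  ultimately show ?thesis by (simp add: clinear_iff)
qed

lemma free_lift_single: "free_lift B (Poly_Mapping.single (x, y) 1) = B x y"
  by (simp add: free_lift_def scaleC_one)

lemma free_lift_relators:
  assumes "cbilinear B" "f \<in> complex_vector.span tensor_relators"
  shows "free_lift B f = 0"
proof -
  interpret L: Vector_Spaces.linear scaleC scaleC "free_lift B" by (rule free_lift_linear)
  show ?thesis
  proof (rule L.eq_0_on_span[OF _ assms(2)])
    fix r :: "'a \<times> 'b \<Rightarrow>\<^sub>0 complex" assume "r \<in> tensor_relators"
    then show "free_lift B r = 0"
      using assms(1) unfolding tensor_relators_def cbilinear_def clinear_iff
      by (auto simp: L.diff L.scale free_lift_single)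
  qed
qed

lemma tensor_lift_abs:
  assumes "cbilinear B"
  shows "tensor_lift B (abs_tensor f) = free_lift B f"
proof -
  interpret L: Vector_Spaces.linear scaleC scaleC "free_lift B" by (rule free_lift_linear)
  have "tensor_rel (rep_tensor (abs_tensor f)) f"
    by (rule Quotient3_rep_abs[OF Quotient3_tensor]) (rule equivp_reflp[OF equivp_tensor_rel])
  then have "free_lift B (rep_tensor (abs_tensor f) - f) = 0"
    using free_lift_relators[OF assms] by (simp add: tensor_rel_def)
  then show ?thesis by (simp add: tensor_lift_def L.diff)
qed

theorem tensor_lift_pure: "cbilinear B \<Longrightarrow> tensor_lift B (x \<otimes> y) = B x y"
  by (simp add: tensor_pure.abs_eq tensor_lift_abs free_lift_single)

theorem tensor_lift_linear:
  assumes "cbilinear B"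
  shows "clinear (tensor_lift B)"
proof -
  interpret L: Vector_Spaces.linear scaleC scaleC "free_lift B" by (rule free_lift_linear)
  have "tensor_lift B (s + t) = tensor_lift B s + tensor_lift B t" for s t
    by (induct s, induct t) (simp add: plus_tensor.abs_eq tensor_lift_abs assms L.add)
  moreover have "tensor_lift B (c *\<^sub>C s) = c *\<^sub>C tensor_lift B s" for c s
    by (induct s) (simp add: scaleC_tensor.abs_eq tensor_lift_abs assms L.scale)
  ultimately show ?thesis by (simp add: clinear_iff)
qed

lemma tensor_span_pure: "complex_vector.span (range (\<lambda>(x, y). x \<otimes> y)) = UNIV"
proof -
  let ?S = "complex_vector.span (range (\<lambda>(x::'a, y::'b). x \<otimes> y))"
  have zero: "abs_tensor 0 = (0 :: ('a, 'b) tensor)" by (simp add: zero_tensor.abs_eq)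
  have "t \<in> ?S" for t
  proof (induct t)
    fix f :: "'a \<times> 'b \<Rightarrow>\<^sub>0 complex"
    show "abs_tensor f \<in> ?S"
    proof (induct f rule: update_induct)
      case const
      show ?case by (metis complex_vector.span_zero zero)
    next
      case (update f p c)
      have "Poly_Mapping.update p c f = f + c *\<^sub>C Poly_Mapping.single p (1::complex)"
        using update(1) by (intro poly_mapping_eqI)
          (auto simp: lookup_update lookup_add lookup_single when_def in_keys_iff)
      then have "abs_tensor (Poly_Mapping.update p c f) = abs_tensor f + c *\<^sub>C (fst p \<otimes> snd p)"
        by (simp add: scaleC_tensor.abs_eq tensor_pure.abs_eq plus_tensor.abs_eq)
      moreover have "fst p \<otimes> snd p \<in> ?S"
        by (rule complex_vector.span_base) (auto intro: image_eqI[where x = p] simp: case_prod_beta)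
      ultimately show ?case using update(3)
        by (simp add: complex_vector.span_add complex_vector.span_scale)
    qed
  qed
  then show ?thesis by blast
qed

theorem tensor_ext:
  assumes "clinear F" "clinear G" "\<And>x y. F (x \<otimes> y) = G (x \<otimes> y)"
  shows "F = G"
proof
  fix t
  interpret P: vector_space_pair "scaleC :: complex \<Rightarrow> ('a, 'b) tensor \<Rightarrow> _" "scaleC :: complex \<Rightarrow> 'c \<Rightarrow> 'c"
    by standard
  show "F t = G t"
    by (rule P.linear_eq_on[OF assms(1,2), where B = "range (\<lambda>(x, y). x \<otimes> y)"])
      (use assms(3) tensor_span_pure in auto)
qed


section \<open>Operators on \<open>V \<otimes> V \<otimes> V\<close>\<close>

definition tensor_map ::
  "('a::complex_vector \<Rightarrow> 'c::complex_vector) \<Rightarrow> ('b::complex_vector \<Rightarrow> 'd::complex_vector) \<Rightarrow>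
   ('a, 'b) tensor \<Rightarrow> ('c, 'd) tensor"
  where "tensor_map f g = tensor_lift (\<lambda>x y. f x \<otimes> g y)"

definition twist :: "('a::complex_vector, 'b::complex_vector) tensor \<Rightarrow> ('b, 'a) tensor"
  where "twist = tensor_lift (\<lambda>x y. y \<otimes> x)"

definition assoc_right ::
  "(('a::complex_vector, 'b::complex_vector) tensor, 'c::complex_vector) tensor \<Rightarrow>
   ('a, ('b, 'c) tensor) tensor"
  where "assoc_right = tensor_lift (\<lambda>t z. tensor_lift (\<lambda>x y. x \<otimes> (y \<otimes> z)) t)"

definition assoc_left ::
  "('a::complex_vector, ('b::complex_vector, 'c::complex_vector) tensor) tensor \<Rightarrow>
   (('a, 'b) tensor, 'c) tensor"
  where "assoc_left = tensor_lift (\<lambda>x. tensor_lift (\<lambda>y z. x \<otimes> y \<otimes> z))"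

text \<open>The triple tensor product is taken as \<open>(V \<otimes> V) \<otimes> V\<close>, so \<open>I \<otimes> R\<close>, which lives on
  \<open>V \<otimes> (V \<otimes> V)\<close>, is transported along the canonical associativity isomorphism.\<close>

type_synonym 'a tensor3 = "(('a, 'a) tensor, 'a) tensor"

definition op_left ::
  "(('a::complex_vector, 'a) tensor \<Rightarrow> ('a, 'a) tensor) \<Rightarrow> 'a tensor3 \<Rightarrow> 'a tensor3"
  where "op_left R = tensor_map R id"

definition op_right ::
  "(('a::complex_vector, 'a) tensor \<Rightarrow> ('a, 'a) tensor) \<Rightarrow> 'a tensor3 \<Rightarrow> 'a tensor3"
  where "op_right R = assoc_left \<circ> tensor_map id R \<circ> assoc_right"

definition R12 where "R12 R = op_left R"
definition R23 where "R23 R = op_right R"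
definition R13 where "R13 R = op_right twist \<circ> op_left R \<circ> op_right twist"

definition QYBE :: "(('a::complex_vector, 'a) tensor \<Rightarrow> ('a, 'a) tensor) \<Rightarrow> bool"
  where "QYBE R \<longleftrightarrow> R12 R \<circ> R13 R \<circ> R23 R = R23 R \<circ> R13 R \<circ> R12 R"

lemma cbilinear_compose:
  "\<lbrakk>cbilinear B; clinear f; clinear g\<rbrakk> \<Longrightarrow> cbilinear (\<lambda>x y. B (f x) (g y))"
  by (simp add: cbilinear_def clinear_iff)

lemma clinear_id: "clinear id"
  by (simp add: clinear_iff)

lemma clinear_compose: "\<lbrakk>clinear f; clinear g\<rbrakk> \<Longrightarrow> clinear (f \<circ> g)"
  by (simp add: clinear_iff)

lemma tensor_pure_add_left: "(x + x') \<otimes> y = x \<otimes> y + x' \<otimes> y"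
  and tensor_pure_add_right: "x \<otimes> (y + y') = x \<otimes> y + x \<otimes> y'"
  and tensor_pure_scaleC_left: "(c *\<^sub>C x) \<otimes> y = c *\<^sub>C (x \<otimes> y)"
  and tensor_pure_scaleC_right: "x \<otimes> (c *\<^sub>C y) = c *\<^sub>C (x \<otimes> y)"
  by (simp_all add: tensor_pure_bilinear[unfolded cbilinear_def clinear_iff])

lemmas tensor_pure_simps =
  tensor_pure_add_left tensor_pure_add_right tensor_pure_scaleC_left tensor_pure_scaleC_right

lemma
  assumes "clinear f" "clinear g"
  shows tensor_map_pure: "tensor_map f g (x \<otimes> y) = f x \<otimes> g y"
    and tensor_map_linear: "clinear (tensor_map f g)"
  using cbilinear_compose[OF tensor_pure_bilinear assms]
  by (simp_all add: tensor_map_def tensor_lift_pure tensor_lift_linear)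

lemma cbilinear_flip: "cbilinear (\<lambda>x y. y \<otimes> x)"
  by (simp add: cbilinear_def clinear_iff tensor_pure_simps)

lemma twist_pure: "twist (x \<otimes> y) = y \<otimes> x"
  and twist_linear: "clinear twist"
  by (simp_all add: twist_def tensor_lift_pure tensor_lift_linear cbilinear_flip)

lemma tensor_lift_add:
  assumes "cbilinear B" "cbilinear C"
  shows "tensor_lift (\<lambda>x y. B x y + C x y) t = tensor_lift B t + tensor_lift C t"
proof -
  have BC: "cbilinear (\<lambda>x y. B x y + C x y)"
    using assms by (simp add: cbilinear_def clinear_iff scaleC_add_right algebra_simps)
  have "tensor_lift (\<lambda>x y. B x y + C x y) = (\<lambda>t. tensor_lift B t + tensor_lift C t)"
    by (rule tensor_ext[OF tensor_lift_linear[OF BC]])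
      (use tensor_lift_linear[OF assms(1)] tensor_lift_linear[OF assms(2)] assms BC in
        \<open>simp_all add: clinear_iff scaleC_add_right algebra_simps tensor_lift_pure\<close>)
  then show ?thesis by simp
qed

lemma tensor_lift_scaleC:
  assumes "cbilinear B"
  shows "tensor_lift (\<lambda>x y. c *\<^sub>C B x y) t = c *\<^sub>C tensor_lift B t"
proof -
  have cB: "cbilinear (\<lambda>x y. c *\<^sub>C B x y)"
    using assms by (simp add: cbilinear_def clinear_iff scaleC_add_right scaleC_scaleC mult.commute)
  have "tensor_lift (\<lambda>x y. c *\<^sub>C B x y) = (\<lambda>t. c *\<^sub>C tensor_lift B t)"
    by (rule tensor_ext[OF tensor_lift_linear[OF cB]])
      (use tensor_lift_linear[OF assms] assms cB in
        \<open>simp_all add: clinear_iff scaleC_add_right scaleC_scaleC mult.commute tensor_lift_pure\<close>)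
  then show ?thesis by simp
qed

lemma assoc_right_inner: "cbilinear (\<lambda>x y. x \<otimes> (y \<otimes> z))"
  by (simp add: cbilinear_def clinear_iff tensor_pure_simps)

lemma assoc_right_outer: "cbilinear (\<lambda>t z. tensor_lift (\<lambda>x y. x \<otimes> (y \<otimes> z)) t)"
  by (simp add: cbilinear_def clinear_iff tensor_pure_simps tensor_lift_add tensor_lift_scaleC
      assoc_right_inner tensor_lift_linear[OF assoc_right_inner, unfolded clinear_iff])

lemma assoc_right_pure: "assoc_right (x \<otimes> y \<otimes> z) = x \<otimes> (y \<otimes> z)"
  by (simp add: assoc_right_def tensor_lift_pure assoc_right_inner assoc_right_outer)

lemma assoc_right_linear: "clinear assoc_right"
  by (simp add: assoc_right_def tensor_lift_linear assoc_right_outer)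

lemma assoc_left_inner: "cbilinear (\<lambda>y z. x \<otimes> y \<otimes> z)"
  by (simp add: cbilinear_def clinear_iff tensor_pure_simps)

lemma assoc_left_outer:
  "cbilinear (\<lambda>x. tensor_lift (\<lambda>y z. x \<otimes> y \<otimes> z) ::
     ('b::complex_vector, 'c::complex_vector) tensor \<Rightarrow> (('a::complex_vector, 'b) tensor, 'c) tensor)"
proof -
  have "tensor_lift (\<lambda>y z. (x + x') \<otimes> y \<otimes> z) t =
      tensor_lift (\<lambda>y z. x \<otimes> y \<otimes> z) t + tensor_lift (\<lambda>y z. x' \<otimes> y \<otimes> z) t"
    for x x' :: 'a and t :: "('b, 'c) tensor"
    unfolding tensor_lift_add[OF assoc_left_inner assoc_left_inner, symmetric]
    by (simp only: tensor_pure_simps)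
  moreover have "tensor_lift (\<lambda>y z. (c *\<^sub>C x) \<otimes> y \<otimes> z) t =
      c *\<^sub>C tensor_lift (\<lambda>y z. x \<otimes> y \<otimes> z) t"
    for c and x :: 'a and t :: "('b, 'c) tensor"
    unfolding tensor_lift_scaleC[OF assoc_left_inner, symmetric]
    by (simp only: tensor_pure_simps)
  ultimately show ?thesis
    by (simp add: cbilinear_def clinear_iff
        tensor_lift_linear[OF assoc_left_inner, unfolded clinear_iff])
qed

lemma assoc_left_pure: "assoc_left (x \<otimes> (y \<otimes> z)) = x \<otimes> y \<otimes> z"
  by (simp add: assoc_left_def tensor_lift_pure[OF assoc_left_outer]
      tensor_lift_pure[OF assoc_left_inner])

lemma assoc_left_linear: "clinear assoc_left"
  by (simp add: assoc_left_def tensor_lift_linear assoc_left_outer)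


section \<open>\<open>(G, \<theta>)\<close>-Lie algebras\<close>

text \<open>The grading group is a type \<open>'g\<close>, the underlying vector space a type \<open>'l\<close>. As \<open>'g\<close> is
  finite, unique decomposition into a sum over all degrees says that \<open>'l\<close> is the direct sum of
  the \<open>L a\<close>.\<close>

locale graded_space =
  fixes L :: "'g::{finite, ab_group_add} \<Rightarrow> 'l::complex_vector set"
  assumes subspace_component: "complex_vector.subspace (L a)"
    and direct_sum: "\<exists>!f. (\<forall>a. f a \<in> L a) \<and> x = (\<Sum>a\<in>UNIV. f a)"

locale theta_Lie_algebra = graded_space L
  for L :: "'g::{finite, ab_group_add} \<Rightarrow> 'l::complex_vector set" +
  fixes \<theta> :: "'g \<Rightarrow> 'g \<Rightarrow> complex"
    and bracket :: "'l \<Rightarrow> 'l \<Rightarrow> 'l"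
  assumes bracket_bilinear: "cbilinear bracket"
    and bracket_graded: "\<lbrakk>x \<in> L a; y \<in> L b\<rbrakk> \<Longrightarrow> bracket x y \<in> L (a + b)"
    and theta_nonzero: "\<theta> a b \<noteq> 0"
    and theta_add_left: "\<theta> (a + b) c = \<theta> a c * \<theta> b c"
    and theta_add_right: "\<theta> a (b + c) = \<theta> a b * \<theta> a c"
    and theta_skew: "\<theta> a b * \<theta> b a = 1"
    and bracket_skew:
      "\<lbrakk>x \<in> L a; y \<in> L b\<rbrakk> \<Longrightarrow> bracket x y = - (\<theta> a b *\<^sub>C bracket y x)"
    and theta_Jacobi:
      "\<lbrakk>x \<in> L a; y \<in> L b; t \<in> L c\<rbrakk> \<Longrightarrow>
        \<theta> c a *\<^sub>C bracket x (bracket y t) + \<theta> b c *\<^sub>C bracket t (bracket x y)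
          + \<theta> a b *\<^sub>C bracket y (bracket t x) = 0"

definition center :: "('l::complex_vector \<Rightarrow> 'l \<Rightarrow> 'l) \<Rightarrow> 'l set"
  where "center bracket = {z. \<forall>x. bracket z x = 0}"

text \<open>A family of bilinear prescriptions, one for each pair of degrees, determines exactly one
  linear map on the tensor square; so a linear map may be defined by its values on \<open>x \<otimes> y\<close> with
  \<open>x\<close>, \<open>y\<close> homogeneous.\<close>

context graded_space
begin

definition component :: "'l \<Rightarrow> 'g \<Rightarrow> 'l"
  where "component x = (THE f. (\<forall>a. f a \<in> L a) \<and> x = (\<Sum>a\<in>UNIV. f a))"

lemma component: "component x a \<in> L a" "(\<Sum>a\<in>UNIV. component x a) = x"
  using theI'[OF direct_sum[of x]] unfolding component_def by auto

lemma component_unique: "\<lbrakk>\<And>a. f a \<in> L a; x = (\<Sum>a\<in>UNIV. f a)\<rbrakk> \<Longrightarrow> component x = f"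
  unfolding component_def by (rule the1_equality[OF direct_sum]) auto

lemma component_add: "component (x + y) a = component x a + component y a"
proof -
  have "component (x + y) = (\<lambda>a. component x a + component y a)"
    by (rule component_unique)
      (auto simp: component sum.distrib complex_vector.subspace_add[OF subspace_component])
  then show ?thesis by simp
qed

lemma component_scaleC: "component (c *\<^sub>C x) a = c *\<^sub>C component x a"
proof -
  have "component (c *\<^sub>C x) = (\<lambda>a. c *\<^sub>C component x a)"
    by (rule component_unique)
      (auto simp: component complex_vector.scale_sum_right[symmetric]
        complex_vector.subspace_scale[OF subspace_component])
  then show ?thesis by simp
qed

lemma component_homogeneous:
  assumes "x \<in> L a"
  shows "component x b = (if b = a then x else 0)"
proof -
  have "component x = (\<lambda>b. if b = a then x else 0)"
    by (rule component_unique)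
      (use assms in \<open>auto simp: sum.delta complex_vector.subspace_0[OF subspace_component]\<close>)
  then show ?thesis by simp
qed

lemma linear_on_homogeneous_unique_ex:
  fixes B :: "'g \<Rightarrow> 'g \<Rightarrow> 'l \<Rightarrow> 'l \<Rightarrow> 'm::complex_vector"
  assumes B: "\<And>a b. cbilinear (B a b)"
  shows "\<exists>!F. clinear F \<and> (\<forall>a b. \<forall>x\<in>L a. \<forall>y\<in>L b. F (x \<otimes> y) = B a b x y)"
proof (rule ex_ex1I)
  let ?C = "\<lambda>x y. \<Sum>a\<in>UNIV. \<Sum>b\<in>UNIV. B a b (component x a) (component y b)"
  have C: "cbilinear ?C"
    using B by (simp add: cbilinear_def clinear_iff component_add component_scaleC sum.distrib
        complex_vector.scale_sum_right)
  have "tensor_lift ?C (x \<otimes> y) = B a b x y" if "x \<in> L a" "y \<in> L b" for a b x y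
  proof -
    have zero: "B a' b' 0 w = 0" "B a' b' w 0 = 0" for a' b' w
      using B[of a' b'] unfolding cbilinear_def clinear_iff
      by (metis add_cancel_right_right)+
    have "B a' b' (component x a') (component y b') =
        (if a' = a then if b' = b then B a b x y else 0 else 0)" for a' b'
      using that by (simp add: component_homogeneous zero)
    then have "?C x y = (\<Sum>a'\<in>UNIV. if a' = a then \<Sum>b'\<in>UNIV. if b' = b then B a b x y else 0 else 0)"
      by (intro sum.cong) auto
    then show ?thesis by (simp add: tensor_lift_pure[OF C] sum.delta)
  qed
  then show "\<exists>F. clinear F \<and> (\<forall>a b. \<forall>x\<in>L a. \<forall>y\<in>L b. F (x \<otimes> y) = B a b x y)"
    using tensor_lift_linear[OF C] by blast
next
  fix F G :: "('l, 'l) tensor \<Rightarrow> 'm"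
  assume F: "clinear F \<and> (\<forall>a b. \<forall>x\<in>L a. \<forall>y\<in>L b. F (x \<otimes> y) = B a b x y)"
    and G: "clinear G \<and> (\<forall>a b. \<forall>x\<in>L a. \<forall>y\<in>L b. G (x \<otimes> y) = B a b x y)"
  have *: "H (x \<otimes> y) = (\<Sum>a\<in>UNIV. \<Sum>b\<in>UNIV. B a b (component x a) (component y b))"
    if H: "clinear H \<and> (\<forall>a b. \<forall>x\<in>L a. \<forall>y\<in>L b. H (x \<otimes> y) = B a b x y)" for H x y
  proof -
    interpret H: Vector_Spaces.linear scaleC scaleC H using H by blast
    interpret l: Vector_Spaces.linear scaleC scaleC "\<lambda>x. x \<otimes> y"
      by (simp add: clinear_iff tensor_pure_simps)
    have r: "x' \<otimes> (\<Sum>b\<in>UNIV. f b) = (\<Sum>b\<in>UNIV. x' \<otimes> f b)" for x' and f :: "'g \<Rightarrow> 'l"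
    proof -
      interpret r: Vector_Spaces.linear scaleC scaleC "\<lambda>y::'l. x' \<otimes> y"
        by (simp add: clinear_iff tensor_pure_simps)
      show ?thesis by (rule r.sum)
    qed
    have "x \<otimes> y = (\<Sum>a\<in>UNIV. component x a \<otimes> y)"
      by (subst l.sum[symmetric]) (simp add: component)
    also have "\<dots> = (\<Sum>a\<in>UNIV. \<Sum>b\<in>UNIV. component x a \<otimes> component y b)"
      by (simp add: r[symmetric] component)
    finally have "H (x \<otimes> y) = (\<Sum>a\<in>UNIV. \<Sum>b\<in>UNIV. H (component x a \<otimes> component y b))"
      by (simp add: H.sum)
    moreover have "H (component x a \<otimes> component y b) = B a b (component x a) (component y b)" for a b
      using H component(1) by blast
    ultimately show ?thesis by simp
  qed
  show "F = G" using F G by (intro tensor_ext) (auto simp: *)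
qed

end

end

theory Submission
  imports Defs
begin

text \<open>
  On homogeneous \<open>x\<close>, \<open>y\<close>, \<open>t\<close> of degrees \<open>a\<close>, \<open>b\<close>, \<open>c\<close>, both sides of the Yang-Baxter equation
  expand into the terms \<open>x \<otimes> [y,t] \<otimes> z\<close>, \<open>[x,t] \<otimes> y \<otimes> z\<close>, \<open>[x,y] \<otimes> z \<otimes> t\<close>, a double bracket
  times \<open>z \<otimes> z\<close>, and \<open>x \<otimes> y \<otimes> t\<close>; centrality of \<open>z\<close> removes every other term. The last of these
  cancels, and the difference of the two sides (lemma \<open>Yang_Baxter_defect\<close>) has the coefficients
  \<open>\<theta> a g - 1\<close>, \<open>1 - \<theta> b g\<close> and \<open>1 - \<theta> g c\<close>, up to \<open>\<alpha>\<close> and values of \<open>\<theta>\<close> as factors, on the first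
  three. If \<open>\<theta>\<close> is trivial against \<open>g\<close> these vanish, and the double brackets that remain cancel by
  the Jacobi identity, which in left-normed form (lemma \<open>Jacobi_left_normed\<close>) reads
  \<open>[x,[y,t]] + \<theta> b c [[x,t],y] = [[x,y],t]\<close>. The inverse formula is a check on homogeneous tensors.

  Conversely, let the equation hold with \<open>\<alpha>\<close>, \<open>z\<close> and the bracket nonzero. The defect
  vanishes, and the aim is to isolate its first term, for an arbitrary nonzero \<open>x\<close> of
  degree \<open>a\<close> and suitable \<open>y\<close>, \<open>t\<close> with \<open>[y,t] \<noteq> 0\<close>. A functional supported in degrees
  \<open>(a, b + c, g)\<close> does this unless another term has these same degrees with a nonzero coefficient
  (lemma \<open>isolated_term_vanishes\<close>). Taking \<open>x = z\<close>, all other terms contain a bracket with \<open>z\<close>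
  and are zero, so \<open>\<theta> g g = 1\<close>. For general \<open>x\<close> one may assume \<open>g \<noteq> 0\<close>; then the double-bracket term
  would need \<open>b + c = 0\<close> and \<open>b + c = g\<close>, the third term would need \<open>c = g\<close>, where its coefficient
  \<open>1 - \<theta> g g\<close> is already known to be zero, and the second would need \<open>c = 0\<close>. By skew-symmetry
  \<open>y\<close> and \<open>t\<close> may be exchanged, so \<open>c = 0\<close> can be avoided except when also \<open>b = 0\<close>, and then the
  coefficient \<open>1 - \<theta> 0 g\<close> is zero.
\<close>

section \<open>Operators on the triple tensor product\<close>

lemma tensor_pure_zero_left [simp]: "0 \<otimes> y = 0"
  using tensor_pure_scaleC_left[of 0 0 y] by simp

lemma tensor_pure_zero_right [simp]: "x \<otimes> 0 = 0"
  using tensor_pure_scaleC_right[of x 0 0] by simp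

lemma op_left_linear: "clinear R \<Longrightarrow> clinear (op_left R)"
  by (simp add: op_left_def tensor_map_linear clinear_id)

lemma op_right_linear: "clinear R \<Longrightarrow> clinear (op_right R)"
  unfolding op_right_def
  by (intro clinear_compose tensor_map_linear assoc_left_linear assoc_right_linear clinear_id)

lemma R12_linear: "clinear R \<Longrightarrow> clinear (R12 R)"
  by (simp add: R12_def op_left_linear)

lemma R23_linear: "clinear R \<Longrightarrow> clinear (R23 R)"
  by (simp add: R23_def op_right_linear)

lemma R13_linear: "clinear R \<Longrightarrow> clinear (R13 R)"
  unfolding R13_def by (intro clinear_compose op_right_linear op_left_linear twist_linear)

lemma R12_pure: "clinear R \<Longrightarrow> R12 R (x \<otimes> y \<otimes> t) = R (x \<otimes> y) \<otimes> t"
  by (simp add: R12_def op_left_def tensor_map_pure clinear_id)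

lemma R23_pure: "clinear R \<Longrightarrow> R23 R (x \<otimes> y \<otimes> t) = assoc_left (x \<otimes> R (y \<otimes> t))"
  by (simp add: R23_def op_right_def assoc_right_pure tensor_map_pure clinear_id)

lemma op_right_twist_pure: "op_right twist (x \<otimes> y \<otimes> t) = x \<otimes> t \<otimes> y"
  by (simp add: op_right_def assoc_right_pure tensor_map_pure clinear_id twist_linear twist_pure
      assoc_left_pure)

lemma R13_pure: "clinear R \<Longrightarrow> R13 R (x \<otimes> y \<otimes> t) = op_right twist (R (x \<otimes> t) \<otimes> y)"
  by (simp add: R13_def op_right_twist_pure op_left_def tensor_map_pure clinear_id)

text \<open>A product of linear functionals is a linear functional on the triple tensor product; such
  functionals are used to read off single terms of an identity between tensors.\<close>

lemma product_functional_exists: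
  fixes f f' f'' :: "'a::complex_vector \<Rightarrow> complex"
  assumes f: "clinear f" "clinear f'" "clinear f''"
  obtains \<phi> :: "'a tensor3 \<Rightarrow> complex"
  where "clinear \<phi>" "\<And>x y t. \<phi> (x \<otimes> y \<otimes> t) = f x * f' y * f'' t"
proof -
  have in2: "cbilinear (\<lambda>x y. f x * f' y)"
    using f by (simp add: cbilinear_def clinear_iff algebra_simps)
  have in3: "cbilinear (\<lambda>s t. tensor_lift (\<lambda>x y. f x * f' y) s * f'' t)"
    using f tensor_lift_linear[OF in2] by (simp add: cbilinear_def clinear_iff algebra_simps)
  show ?thesis
    by (rule that[OF tensor_lift_linear[OF in3]]) (simp add: tensor_lift_pure in2 in3)
qed

section \<open>Homogeneous elements\<close>

context graded_space
begin

lemma linear_eq_on_homogeneous: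
  assumes "clinear F" "clinear G" "\<And>a x. \<lbrakk>x \<in> L a; x \<noteq> 0\<rbrakk> \<Longrightarrow> F x = G x"
  shows "F = G"
proof
  fix x
  interpret F: Vector_Spaces.linear scaleC scaleC F by fact
  interpret G: Vector_Spaces.linear scaleC scaleC G by fact
  have "F (component x a) = G (component x a)" for a
    using assms(3) component(1) by (cases "component x a = 0") (auto simp: F.zero G.zero)
  then have "F (\<Sum>a\<in>UNIV. component x a) = G (\<Sum>a\<in>UNIV. component x a)"
    by (simp add: F.sum G.sum)
  then show "F x = G x" by (simp add: component)
qed

text \<open>Nonzero arguments suffice in the next two lemmas because a tensor with a zero factor is zero.
  They are used where a condition on \<open>\<theta>\<close> is known only at the degrees of nonzero elements.\<close>

lemma tensor_ext_homogeneous: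
  fixes F G :: "('l, 'l) tensor \<Rightarrow> 'm::complex_vector"
  assumes F: "clinear F" and G: "clinear G"
    and eq: "\<And>a b x y. \<lbrakk>x \<in> L a; y \<in> L b; x \<noteq> 0; y \<noteq> 0\<rbrakk> \<Longrightarrow> F (x \<otimes> y) = G (x \<otimes> y)"
  shows "F = G"
proof (rule tensor_ext[OF F G])
  fix x y
  have lin: "clinear (\<lambda>x. H (x \<otimes> y))" "clinear (\<lambda>y. H (x \<otimes> y))"
    if "clinear H" for H :: "('l, 'l) tensor \<Rightarrow> 'm" and x y
    using that by (simp_all add: clinear_iff tensor_pure_simps)
  have "(\<lambda>y. F (x \<otimes> y)) = (\<lambda>y. G (x \<otimes> y))" if "x \<in> L a" "x \<noteq> 0" for a x
    using eq that by (intro linear_eq_on_homogeneous lin F G) blast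
  then have "(\<lambda>x. F (x \<otimes> y)) = (\<lambda>x. G (x \<otimes> y))"
    by (intro linear_eq_on_homogeneous lin F G) metis
  then show "F (x \<otimes> y) = G (x \<otimes> y)" by metis
qed

lemma tensor3_ext_homogeneous:
  fixes F G :: "'l tensor3 \<Rightarrow> 'm::complex_vector"
  assumes F: "clinear F" and G: "clinear G"
    and eq: "\<And>a b c x y t. \<lbrakk>x \<in> L a; y \<in> L b; t \<in> L c; x \<noteq> 0; y \<noteq> 0; t \<noteq> 0\<rbrakk>
               \<Longrightarrow> F (x \<otimes> y \<otimes> t) = G (x \<otimes> y \<otimes> t)"
  shows "F = G"
proof (rule tensor_ext[OF F G])
  fix s t
  have lin: "clinear (\<lambda>s. H (s \<otimes> t))" "clinear (\<lambda>t. H (s \<otimes> t))"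
    if "clinear H" for H :: "'l tensor3 \<Rightarrow> 'm" and s t
    using that by (simp_all add: clinear_iff tensor_pure_simps)
  have "(\<lambda>s. F (s \<otimes> t)) = (\<lambda>s. G (s \<otimes> t))" if "t \<in> L c" "t \<noteq> 0" for c t
    using eq that by (intro tensor_ext_homogeneous lin F G) blast
  then have "(\<lambda>t. F (s \<otimes> t)) = (\<lambda>t. G (s \<otimes> t))"
    by (intro linear_eq_on_homogeneous lin F G) metis
  then show "F (s \<otimes> t) = G (s \<otimes> t)" by metis
qed

text \<open>Precomposing a functional that is \<open>1\<close> at \<open>x\<close> with the projection to degree \<open>a\<close> gives one that
  detects \<open>x\<close> and ignores all other degrees.\<close>

lemma homogeneous_functional_exists:
  assumes "x \<in> L a" "x \<noteq> 0"
  obtains f :: "'l \<Rightarrow> complex"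
  where "clinear f" "f x = 1" "\<And>b y. \<lbrakk>y \<in> L b; b \<noteq> a\<rbrakk> \<Longrightarrow> f y = 0"
proof -
  interpret P: vector_space_pair "scaleC :: complex \<Rightarrow> 'l \<Rightarrow> 'l" "scaleC :: complex \<Rightarrow> complex \<Rightarrow> complex"
    by standard
  obtain h :: "'l \<Rightarrow> complex" where h: "clinear h" "h x = 1"
    using P.linear_independent_extend[of "{x}" "\<lambda>_. 1"] assms(2) by auto
  interpret h: Vector_Spaces.linear scaleC scaleC h by (rule h)
  show ?thesis
  proof (rule that[of "\<lambda>y. h (component y a)"])
    show "clinear (\<lambda>y. h (component y a))"
      using h(1) by (simp add: clinear_iff component_add component_scaleC)
  qed (use assms h in \<open>auto simp: component_homogeneous h.zero\<close>)
qed

end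

section \<open>The Yang-Baxter defect\<close>

locale central_bracket_operator = theta_Lie_algebra L \<theta> bracket
  for L :: "'g::{finite, ab_group_add} \<Rightarrow> 'l::complex_vector set"
    and \<theta> :: "'g \<Rightarrow> 'g \<Rightarrow> complex" and bracket :: "'l \<Rightarrow> 'l \<Rightarrow> 'l" +
  fixes \<alpha> :: complex and z :: 'l and g :: 'g and R :: "('l, 'l) tensor \<Rightarrow> ('l, 'l) tensor"
  assumes z_center: "z \<in> center bracket" and z_degree: "z \<in> L g" and R_linear: "clinear R"
    and R_pure: "\<lbrakk>x \<in> L a; y \<in> L b\<rbrakk> \<Longrightarrow>
      R (x \<otimes> y) = \<alpha> *\<^sub>C (bracket x y \<otimes> z) + \<theta> a b *\<^sub>C (x \<otimes> y)"
begin

lemma theta_0_left: "\<theta> 0 a = 1"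
  using theta_add_left[of 0 0 a] theta_nonzero[of 0 a] by simp

lemma theta_0_right: "\<theta> a 0 = 1"
  using theta_skew[of a 0] theta_0_left by simp

lemma bracket_linear_right: "clinear (bracket x)"
  and bracket_linear_left: "clinear (\<lambda>x. bracket x y)"
  using bracket_bilinear by (simp_all add: cbilinear_def)

lemma bracket_scaleC_right: "bracket x (c *\<^sub>C y) = c *\<^sub>C bracket x y"
  using bracket_linear_right by (simp add: clinear_iff)

lemma bracket_zero_left: "bracket 0 x = 0"
  using bracket_linear_left by (metis add_cancel_right_right clinear_iff)

lemma bracket_minus_right: "bracket x (- y) = - bracket x y"
  using bracket_scaleC_right[of x "-1" y] by simp

lemma bracket_z_left: "bracket z x = 0"
  using z_center by (simp add: center_def)

text \<open>The center is defined by brackets from the left; homogeneity of \<open>z\<close> lets skew-symmetry, which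
  holds degree by degree, carry this over to the right.\<close>

lemma bracket_z_right: "bracket x z = 0"
proof -
  interpret l: Vector_Spaces.linear scaleC scaleC "\<lambda>x. bracket x z"
    by (rule bracket_linear_left)
  have "bracket (component x a) z = 0" for a
    using bracket_skew[OF component(1) z_degree, of x a] by (simp add: bracket_z_left)
  then have "(\<Sum>a\<in>UNIV. bracket (component x a) z) = 0" by simp
  then show ?thesis by (simp add: l.sum[symmetric] component)
qed

lemma R12_homogeneous:
  assumes "x \<in> L a" "y \<in> L b"
  shows "R12 R (x \<otimes> y \<otimes> t) = \<alpha> *\<^sub>C (bracket x y \<otimes> z \<otimes> t) + \<theta> a b *\<^sub>C (x \<otimes> y \<otimes> t)"
  by (simp add: R12_pure[OF R_linear] R_pure[OF assms] tensor_pure_simps)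

lemma R23_homogeneous:
  assumes "y \<in> L b" "t \<in> L c"
  shows "R23 R (x \<otimes> y \<otimes> t) = \<alpha> *\<^sub>C (x \<otimes> bracket y t \<otimes> z) + \<theta> b c *\<^sub>C (x \<otimes> y \<otimes> t)"
  by (simp add: assoc_left_linear[unfolded clinear_iff] R23_pure[OF R_linear] R_pure[OF assms]
      tensor_pure_simps assoc_left_pure)

lemma R13_homogeneous:
  assumes "x \<in> L a" "t \<in> L c"
  shows "R13 R (x \<otimes> y \<otimes> t) = \<alpha> *\<^sub>C (bracket x t \<otimes> y \<otimes> z) + \<theta> a c *\<^sub>C (x \<otimes> y \<otimes> t)"
  by (simp add: op_right_linear[OF twist_linear, unfolded clinear_iff] R13_pure[OF R_linear]
      R_pure[OF assms] tensor_pure_simps op_right_twist_pure)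

text \<open>In the next two expansions the scalars are brought to a common form by the bicharacter laws,
  so that the terms \<open>x \<otimes> y \<otimes> t\<close> agree literally. On the left, the coefficient of
  \<open>[x,t] \<otimes> y \<otimes> z\<close> arises as \<open>\<alpha> \<theta> b c \<theta> (a + c) b\<close>, where \<open>\<theta> b c\<close> cancels against \<open>\<theta> c b\<close>;
  on the right, \<open>\<theta> g g\<close> comes from \<open>R\<close> acting on \<open>z \<otimes> z\<close>.\<close>

lemma Yang_Baxter_left:
  assumes x: "x \<in> L a" and y: "y \<in> L b" and t: "t \<in> L c"
  shows "(R12 R \<circ> R13 R \<circ> R23 R) (x \<otimes> y \<otimes> t) =
      (\<alpha> * \<theta> a b * \<theta> a c * \<theta> a g) *\<^sub>C (x \<otimes> bracket y t \<otimes> z)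
    + (\<alpha> * \<theta> a b) *\<^sub>C (bracket x t \<otimes> y \<otimes> z)
    + (\<alpha> * \<theta> a c * \<theta> b c) *\<^sub>C (bracket x y \<otimes> z \<otimes> t)
    + \<alpha>\<^sup>2 *\<^sub>C ((\<theta> a g *\<^sub>C bracket x (bracket y t) + \<theta> b c *\<^sub>C bracket (bracket x t) y) \<otimes> z \<otimes> z)
    + (\<theta> a b * \<theta> a c * \<theta> b c) *\<^sub>C (x \<otimes> y \<otimes> t)"
proof -
  note lin = R12_linear[OF R_linear] R13_linear[OF R_linear] R23_linear[OF R_linear]
  have yt: "bracket y t \<in> L (b + c)" and xt: "bracket x t \<in> L (a + c)"
    using x y t bracket_graded by blast+
  show ?thesis
    using lin
    by (simp add: clinear_iff R23_homogeneous[OF y t] R13_homogeneous[OF x z_degree]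
        R13_homogeneous[OF x t] R12_homogeneous[OF x yt] R12_homogeneous[OF xt y]
        R12_homogeneous[OF x y] bracket_z_right theta_add_left theta_add_right
        tensor_pure_simps scaleC_add_right scaleC_scaleC power2_eq_square ac_simps theta_skew)
qed

lemma Yang_Baxter_right:
  assumes x: "x \<in> L a" and y: "y \<in> L b" and t: "t \<in> L c"
  shows "(R23 R \<circ> R13 R \<circ> R12 R) (x \<otimes> y \<otimes> t) =
      (\<alpha> * \<theta> a b * \<theta> a c) *\<^sub>C (x \<otimes> bracket y t \<otimes> z)
    + (\<alpha> * \<theta> a b * \<theta> b g) *\<^sub>C (bracket x t \<otimes> y \<otimes> z)
    + (\<alpha> * \<theta> a c * \<theta> b c * \<theta> g c) *\<^sub>C (bracket x y \<otimes> z \<otimes> t)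
    + \<alpha>\<^sup>2 *\<^sub>C ((\<theta> g g *\<^sub>C bracket (bracket x y) t) \<otimes> z \<otimes> z)
    + (\<theta> a b * \<theta> a c * \<theta> b c) *\<^sub>C (x \<otimes> y \<otimes> t)"
proof -
  note lin = R12_linear[OF R_linear] R13_linear[OF R_linear] R23_linear[OF R_linear]
  have xy: "bracket x y \<in> L (a + b)"
    using x y bracket_graded by blast
  show ?thesis
    using lin
    by (simp add: clinear_iff R12_homogeneous[OF x y] R13_homogeneous[OF xy t]
        R13_homogeneous[OF x t] R23_homogeneous[OF y t] R23_homogeneous[OF z_degree z_degree]
        R23_homogeneous[OF z_degree t] R23_homogeneous[OF y z_degree]
        bracket_z_right bracket_z_left theta_add_left theta_add_right
        tensor_pure_simps scaleC_add_right scaleC_scaleC power2_eq_square ac_simps)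
qed


lemma Yang_Baxter_defect:
  assumes "x \<in> L a" "y \<in> L b" "t \<in> L c"
  shows "(R12 R \<circ> R13 R \<circ> R23 R) (x \<otimes> y \<otimes> t) - (R23 R \<circ> R13 R \<circ> R12 R) (x \<otimes> y \<otimes> t) =
      (\<alpha> * \<theta> a b * \<theta> a c * (\<theta> a g - 1)) *\<^sub>C (x \<otimes> bracket y t \<otimes> z)
    + (\<alpha> * \<theta> a b * (1 - \<theta> b g)) *\<^sub>C (bracket x t \<otimes> y \<otimes> z)
    + (\<alpha> * \<theta> a c * \<theta> b c * (1 - \<theta> g c)) *\<^sub>C (bracket x y \<otimes> z \<otimes> t)
    + \<alpha>\<^sup>2 *\<^sub>C ((\<theta> a g *\<^sub>C bracket x (bracket y t) + \<theta> b c *\<^sub>C bracket (bracket x t) y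
        - \<theta> g g *\<^sub>C bracket (bracket x y) t) \<otimes> z \<otimes> z)"
proof -
  have minus: "(u - v) \<otimes> w = u \<otimes> w - v \<otimes> w" for u v :: "'b::complex_vector" and w :: "'c::complex_vector"
    using tensor_pure_add_left[of "u - v" v w] by simp
  show ?thesis
    unfolding Yang_Baxter_left[OF assms] Yang_Baxter_right[OF assms]
    by (simp add: minus complex_vector.scale_left_diff_distrib complex_vector.scale_right_diff_distrib
        right_diff_distrib)
qed

section \<open>Sufficiency\<close>

text \<open>Bracketing with \<open>t\<close> on the right is a \<open>\<theta>\<close>-derivation: once skew-symmetry has rewritten
  \<open>[t,[x,y]]\<close> and \<open>[y,[t,x]]\<close> through \<open>[[x,y],t]\<close> and \<open>[[x,t],y]\<close>, the cyclic Jacobi identity is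
  \<open>\<theta> c a\<close> times this one.\<close>

lemma Jacobi_left_normed:
  assumes x: "x \<in> L a" and y: "y \<in> L b" and t: "t \<in> L c"
  shows "bracket x (bracket y t) + \<theta> b c *\<^sub>C bracket (bracket x t) y = bracket (bracket x y) t"
proof -
  have "bracket t (bracket x y) = - ((\<theta> c a * \<theta> c b) *\<^sub>C bracket (bracket x y) t)"
    using bracket_skew[OF t bracket_graded[OF x y]] by (simp add: theta_add_right)
  moreover have "bracket y (bracket t x) = (\<theta> b a * \<theta> b c * \<theta> c a) *\<^sub>C bracket (bracket x t) y"
    using bracket_skew[OF y bracket_graded[OF x t]]
    by (simp add: bracket_skew[OF t x] bracket_minus_right bracket_scaleC_right theta_add_right
        scaleC_scaleC ac_simps)
  ultimately have "\<theta> c a *\<^sub>C bracket x (bracket y t)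
      - (\<theta> b c * \<theta> c b * \<theta> c a) *\<^sub>C bracket (bracket x y) t
      + (\<theta> a b * \<theta> b a * \<theta> b c * \<theta> c a) *\<^sub>C bracket (bracket x t) y = 0"
    using theta_Jacobi[OF x y t] by (simp add: scaleC_scaleC ac_simps)
  then have "\<theta> c a *\<^sub>C (bracket x (bracket y t) - bracket (bracket x y) t
      + \<theta> b c *\<^sub>C bracket (bracket x t) y) = 0"
    by (simp add: theta_skew scaleC_add_right complex_vector.scale_right_diff_distrib
        scaleC_scaleC ac_simps)
  then have "bracket x (bracket y t) - bracket (bracket x y) t + \<theta> b c *\<^sub>C bracket (bracket x t) y = 0"
    using theta_nonzero[of c a] by (simp only: complex_vector.scale_eq_0_iff) simp
  then show ?thesis by (simp add: algebra_simps)
qed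

context
  assumes theta_g_trivial:
    "\<forall>a. \<forall>x\<in>L a. x \<noteq> 0 \<longrightarrow> \<theta> g a = 1 \<and> \<theta> a g = 1 \<and> \<theta> g g = 1"
begin

lemma QYBE_holds: "QYBE R"
  unfolding QYBE_def
proof (rule tensor3_ext_homogeneous)
  show "clinear (R12 R \<circ> R13 R \<circ> R23 R)" "clinear (R23 R \<circ> R13 R \<circ> R12 R)"
    by (intro clinear_compose R12_linear R13_linear R23_linear R_linear)+
  fix a b c x y t
  assume xyt: "x \<in> L a" "y \<in> L b" "t \<in> L c" and nz: "x \<noteq> 0" "y \<noteq> 0" "t \<noteq> 0"
  have "\<theta> a g = 1" "\<theta> b g = 1" "\<theta> g c = 1" "\<theta> g g = 1"
    using theta_g_trivial xyt nz by blast+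
  then have "(R12 R \<circ> R13 R \<circ> R23 R) (x \<otimes> y \<otimes> t) - (R23 R \<circ> R13 R \<circ> R12 R) (x \<otimes> y \<otimes> t) = 0"
    unfolding Yang_Baxter_defect[OF xyt] by (simp add: Jacobi_left_normed[OF xyt] scaleC_one)
  then show "(R12 R \<circ> R13 R \<circ> R23 R) (x \<otimes> y \<otimes> t) = (R23 R \<circ> R13 R \<circ> R12 R) (x \<otimes> y \<otimes> t)"
    by simp
qed

text \<open>The candidate inverse is defined by the claimed formula. Both \<open>R\<close> and it fix \<open>[x,y] \<otimes> z\<close>, since
  \<open>[x,y]\<close> commutes with \<open>z\<close> and its degree \<open>a + b\<close> is \<open>\<theta>\<close>-trivial against \<open>g\<close>. Hence in either
  composite the bracket terms have total \<open>\<alpha> ([y,x] + \<theta> b a [x,y]) \<otimes> z\<close> or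
  \<open>\<alpha> ([x,y] + \<theta> a b [y,x]) \<otimes> z\<close>, which is zero by skew-symmetry.\<close>

lemma inverse_formula:
  "bij R \<and> (\<forall>a b. \<forall>x\<in>L a. \<forall>y\<in>L b.
     inv R (x \<otimes> y) = \<alpha> *\<^sub>C (bracket y x \<otimes> z) + \<theta> b a *\<^sub>C (x \<otimes> y))"
proof -
  have "cbilinear (\<lambda>x y. \<alpha> *\<^sub>C (bracket y x \<otimes> z) + \<theta> b a *\<^sub>C (x \<otimes> y))" for a b
    using bracket_linear_left bracket_linear_right
    by (simp add: cbilinear_def clinear_iff tensor_pure_simps scaleC_add_right scaleC_scaleC ac_simps)
  from linear_on_homogeneous_unique_ex[of "\<lambda>a b x y. \<alpha> *\<^sub>C (bracket y x \<otimes> z) + \<theta> b a *\<^sub>C (x \<otimes> y)", OF this]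
  obtain S where S_linear: "clinear S"
    and S: "\<And>a b x y. \<lbrakk>x \<in> L a; y \<in> L b\<rbrakk>
      \<Longrightarrow> S (x \<otimes> y) = \<alpha> *\<^sub>C (bracket y x \<otimes> z) + \<theta> b a *\<^sub>C (x \<otimes> y)"
    by blast
  have skew: "bracket y x \<otimes> z = - (\<theta> b a *\<^sub>C (bracket x y \<otimes> z))"
    if "x \<in> L a" "y \<in> L b" for a b x y
    using bracket_skew[OF that(2,1)] tensor_pure_scaleC_left[of "- \<theta> b a" "bracket x y" z] by simp
  interpret R: Vector_Spaces.linear scaleC scaleC R by (rule R_linear)
  interpret S: Vector_Spaces.linear scaleC scaleC S by (rule S_linear)
  have RS: "R \<circ> S = id"
  proof (rule tensor_ext_homogeneous)
    fix a b x y
    assume xy: "x \<in> L a" "y \<in> L b" and nz: "x \<noteq> 0" "y \<noteq> 0"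
    have g: "\<theta> a g = 1" "\<theta> b g = 1"
      using theta_g_trivial xy nz by blast+
    have Rz: "R (bracket x y \<otimes> z) = bracket x y \<otimes> z"
      using R_pure[OF bracket_graded[OF xy] z_degree]
      by (simp add: bracket_z_right theta_add_left g scaleC_one)
    show "(R \<circ> S) (x \<otimes> y) = id (x \<otimes> y)"
      by (simp add: R.add R.diff R.scale R.neg S[OF xy] Rz R_pure[OF xy] skew[OF xy] scaleC_add_right
          scaleC_scaleC theta_skew scaleC_one ac_simps)
  qed (intro clinear_compose R_linear S_linear clinear_id)+
  have SR: "S \<circ> R = id"
  proof (rule tensor_ext_homogeneous)
    fix a b x y
    assume xy: "x \<in> L a" "y \<in> L b" and nz: "x \<noteq> 0" "y \<noteq> 0"
    have g: "\<theta> g a = 1" "\<theta> g b = 1"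
      using theta_g_trivial xy nz by blast+
    have Sz: "S (bracket x y \<otimes> z) = bracket x y \<otimes> z"
      using S[OF bracket_graded[OF xy] z_degree]
      by (simp add: bracket_z_left theta_add_right g scaleC_one)
    show "(S \<circ> R) (x \<otimes> y) = id (x \<otimes> y)"
      by (simp add: S.add S.scale R_pure[OF xy] Sz S[OF xy] skew[OF xy]
          complex_vector.scale_right_diff_distrib scaleC_scaleC theta_skew scaleC_one
          mult.left_commute[of "\<theta> a b" \<alpha>])
  qed (intro clinear_compose R_linear S_linear clinear_id)+
  have "bij R" "inv R = S"
    using RS SR by (auto intro: o_bij inv_unique_comp)
  then show ?thesis using S by simp
qed

end

section \<open>Necessity\<close>

lemma homogeneous_bracket_nonzero:
  assumes "bracket x y \<noteq> 0"
  obtains b c u v where "u \<in> L b" "v \<in> L c" "bracket u v \<noteq> 0"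
proof (rule ccontr)
  assume "\<not> thesis"
  with that have "bracket u v = 0" if "u \<in> L b" "v \<in> L c" for b c u v using that by blast
  then have "bracket u = (\<lambda>_. 0)" if "u \<in> L b" for b u
    using that by (intro linear_eq_on_homogeneous bracket_linear_right) (auto simp: clinear_iff)
  then have "(\<lambda>u. bracket u y) = (\<lambda>_. 0)"
    by (intro linear_eq_on_homogeneous bracket_linear_left) (auto simp: clinear_iff)
  with assms show False by metis
qed

context
  assumes nondegenerate: "\<alpha> \<noteq> 0" "z \<noteq> 0"
    and nonabelian: "\<exists>x y. bracket x y \<noteq> 0"
    and Yang_Baxter: "QYBE R"
begin

text \<open>Each of the last three hypotheses lists ways in which one of the competing terms of the defect
  is invisible to a functional supported in degrees \<open>(a, b + c, g)\<close>: it is zero, its coefficient is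
  zero, or its degrees differ. The competing degrees are \<open>(a + c, b, g)\<close>, \<open>(a + b, g, c)\<close> and
  \<open>(a + b + c, g, g)\<close>; the last can agree with \<open>(a, b + c, g)\<close> only if \<open>g = b + c = 0\<close>.\<close>

lemma isolated_term_vanishes:
  assumes x: "x \<in> L a" "x \<noteq> 0" and y: "y \<in> L b" and t: "t \<in> L c" and yt: "bracket y t \<noteq> 0"
    and second: "bracket x t = 0 \<or> \<theta> b g = 1 \<or> c \<noteq> 0"
    and third: "bracket x y = 0 \<or> \<theta> g c = 1 \<or> b \<noteq> 0 \<or> c \<noteq> g"
    and fourth: "(\<theta> a g *\<^sub>C bracket x (bracket y t) + \<theta> b c *\<^sub>C bracket (bracket x t) y
        - \<theta> g g *\<^sub>C bracket (bracket x y) t = 0) \<or> g \<noteq> 0"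
  shows "\<theta> a g = 1"
proof -
  let ?w = "\<theta> a g *\<^sub>C bracket x (bracket y t) + \<theta> b c *\<^sub>C bracket (bracket x t) y
        - \<theta> g g *\<^sub>C bracket (bracket x y) t"
  note graded = bracket_graded[OF x(1) y] bracket_graded[OF x(1) t] bracket_graded[OF y t]
  obtain f :: "'l \<Rightarrow> complex" where f: "clinear f" "f x = 1" "\<And>b y. \<lbrakk>y \<in> L b; b \<noteq> a\<rbrakk> \<Longrightarrow> f y = 0"
    using homogeneous_functional_exists[OF x] by blast
  obtain f' :: "'l \<Rightarrow> complex" where f': "clinear f'" "f' (bracket y t) = 1"
      "\<And>d y. \<lbrakk>y \<in> L d; d \<noteq> b + c\<rbrakk> \<Longrightarrow> f' y = 0"
    using homogeneous_functional_exists[OF graded(3) yt] by blast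
  obtain f'' :: "'l \<Rightarrow> complex" where f'': "clinear f''" "f'' z = 1" "\<And>b y. \<lbrakk>y \<in> L b; b \<noteq> g\<rbrakk> \<Longrightarrow> f'' y = 0"
    using homogeneous_functional_exists[OF z_degree nondegenerate(2)] by blast
  obtain \<phi> where \<phi>: "clinear \<phi>" "\<And>x y t. \<phi> (x \<otimes> y \<otimes> t) = f x * f' y * f'' t"
    using product_functional_exists[OF f(1) f'(1) f''(1)] by blast
  interpret f: Vector_Spaces.linear scaleC scaleC f by (rule f(1))
  interpret \<phi>: Vector_Spaces.linear scaleC scaleC \<phi> by (rule \<phi>(1))
  have w: "?w \<in> L (a + b + c)"
    using bracket_graded[OF x(1) graded(3)] bracket_graded[OF graded(2) y]
      bracket_graded[OF graded(1) t]
    by (intro complex_vector.subspace_add[OF subspace_component]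
        complex_vector.subspace_diff[OF subspace_component]
        complex_vector.subspace_scale[OF subspace_component]) (simp_all add: ac_simps)
  have 2: "(1 - \<theta> b g) * f (bracket x t) = 0"
    using second f(3)[OF graded(2)] by (auto simp: f.zero)
  have 3: "(1 - \<theta> g c) * (f (bracket x y) * f'' t) = 0"
    using third f(3)[OF graded(1)] f''(3)[OF t] by (auto simp: f.zero)
  have 4: "f ?w * f' z = 0"
  proof (cases "?w = 0")
    case False
    with fourth have "g \<noteq> 0" by blast
    \<comment> \<open>For \<open>b + c \<noteq> 0\<close> the first factor has the wrong degree, and for \<open>b + c = 0 \<noteq> g\<close> the second.\<close>
    then show ?thesis
      using f(3)[OF w] f'(3)[OF z_degree] by (cases "b + c = 0") (auto simp: add.assoc)
  qed (simp add: f.zero)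
  have "(R12 R \<circ> R13 R \<circ> R23 R) (x \<otimes> y \<otimes> t) - (R23 R \<circ> R13 R \<circ> R12 R) (x \<otimes> y \<otimes> t) = 0"
    using Yang_Baxter by (simp add: QYBE_def)
  then have "0 = \<phi> ((\<alpha> * \<theta> a b * \<theta> a c * (\<theta> a g - 1)) *\<^sub>C (x \<otimes> bracket y t \<otimes> z)
    + (\<alpha> * \<theta> a b * (1 - \<theta> b g)) *\<^sub>C (bracket x t \<otimes> y \<otimes> z)
    + (\<alpha> * \<theta> a c * \<theta> b c * (1 - \<theta> g c)) *\<^sub>C (bracket x y \<otimes> z \<otimes> t)
    + \<alpha>\<^sup>2 *\<^sub>C (?w \<otimes> z \<otimes> z))"
    unfolding Yang_Baxter_defect[OF x(1) y t] by (simp add: \<phi>.zero)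
  also have "\<dots> = \<alpha> * \<theta> a b * \<theta> a c * (\<theta> a g - 1)
      + \<alpha> * \<theta> a b * f' y * ((1 - \<theta> b g) * f (bracket x t))
      + \<alpha> * \<theta> a c * \<theta> b c * f' z * ((1 - \<theta> g c) * (f (bracket x y) * f'' t))
      + \<alpha>\<^sup>2 * (f ?w * f' z)"
    using \<phi>(1) by (simp only: clinear_iff \<phi>(2) f(2) f'(2) f''(2) scaleC_complex_def) (simp add: ac_simps)
  finally show ?thesis
    unfolding 2 3 4 using nondegenerate(1) theta_nonzero by simp
qed

lemma theta_g_g: "\<theta> g g = 1"
proof -
  obtain b c y t where "y \<in> L b" "t \<in> L c" "bracket y t \<noteq> 0"
    using nonabelian homogeneous_bracket_nonzero by metis
  then show ?thesis
    using isolated_term_vanishes[OF z_degree nondegenerate(2)]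
    by (simp add: bracket_z_left bracket_zero_left)
qed

lemma theta_g_trivial_if_QYBE:
  assumes x: "x \<in> L a" "x \<noteq> 0"
  shows "\<theta> g a = 1 \<and> \<theta> a g = 1 \<and> \<theta> g g = 1"
proof -
  have "\<theta> a g = 1"
  proof (cases "g = 0")
    case False
    obtain b c y t where 1: "y \<in> L b" "t \<in> L c" "bracket y t \<noteq> 0"
      using nonabelian homogeneous_bracket_nonzero by metis
    have "bracket t y \<noteq> 0"
      using 1 bracket_skew[OF 1(1,2)] by auto
    \<comment> \<open>If \<open>c = 0 \<noteq> b\<close>, exchange \<open>y\<close> and \<open>t\<close>.\<close>
    with 1 obtain b c y t where 2: "y \<in> L b" "t \<in> L c" "bracket y t \<noteq> 0" "c = 0 \<longrightarrow> b = 0"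
      by metis
    show ?thesis
      by (rule isolated_term_vanishes[OF x 2(1-3)])
        (use 2(4) False theta_g_g in \<open>auto simp: theta_0_left\<close>)
  qed (simp add: theta_0_right)
  then show ?thesis using theta_skew[of a g] theta_g_g by simp
qed

end

end

theorem theorem6p1:
  fixes L :: "'g::{finite, ab_group_add} \<Rightarrow> 'l::complex_vector set"
    and \<theta> :: "'g \<Rightarrow> 'g \<Rightarrow> complex"
    and bracket :: "'l \<Rightarrow> 'l \<Rightarrow> 'l"
    and \<alpha> :: complex and z :: 'l and g :: 'g
    and R :: "('l, 'l) tensor \<Rightarrow> ('l, 'l) tensor"
  assumes "theta_Lie_algebra L \<theta> bracket"
    and "z \<in> center bracket" and "z \<in> L g"
    and "clinear R"
    and "\<And>a b x y. x \<in> L a \<Longrightarrow> y \<in> L b \<Longrightarrow>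
           R (x \<otimes> y) = \<alpha> *\<^sub>C (bracket x y \<otimes> z) + \<theta> a b *\<^sub>C (x \<otimes> y)"
  shows
    "(\<alpha> \<noteq> 0 \<and> z \<noteq> 0 \<and> (\<exists>x y. bracket x y \<noteq> 0) \<longrightarrow>
       (QYBE R \<longleftrightarrow>
         (\<forall>a. \<forall>x\<in>L a. x \<noteq> 0 \<longrightarrow> \<theta> g a = 1 \<and> \<theta> a g = 1 \<and> \<theta> g g = 1))) \<and>
     ((\<forall>a. \<forall>x\<in>L a. x \<noteq> 0 \<longrightarrow> \<theta> g a = 1 \<and> \<theta> a g = 1 \<and> \<theta> g g = 1) \<longrightarrow>
       QYBE R \<and> bij R \<and>
       (\<forall>a b. \<forall>x\<in>L a. \<forall>y\<in>L b.
          inv R (x \<otimes> y) = \<alpha> *\<^sub>C (bracket y x \<otimes> z) + \<theta> b a *\<^sub>C (x \<otimes> y)))"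
proof -
  interpret central_bracket_operator L \<theta> bracket \<alpha> z g R
    using assms by (auto simp: central_bracket_operator_def central_bracket_operator_axioms_def)
  show ?thesis
    using theta_g_trivial_if_QYBE QYBE_holds inverse_formula by blast
qed

end
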